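(* Let $N\ge 1$ and $\sigma_*\ge 1$ be integers, let $0<c_0<c$ be constants, and let $v$ be the throttling function with parameter $\sigma_*$. The continuous-time Markov chain $\boldsymbol{\sigma}(t)=(\sigma_1(t),\dots,\sigma_N(t))$ on $\mathbb{N}^N$ described in the context has a unique stationary distribution, given for $\boldsymbol{\alpha}=(\alpha_1,\dots,\alpha_N)\in\mathbb{N}^N$ by $$\pi_{\boldsymbol{\alpha}} = C\,\frac{c_0^{\alpha_1}}{c^{\alpha_1}\prod_{k=1}^{\alpha_1}v(k)}\times\frac{c_0^{\alpha_2}}{c^{\alpha_2}\prod_{k=1}^{\alpha_2}v(k)}\times\cdots\times\frac{c_0^{\alpha_N}}{c^{\alpha_N}\prod_{k=1}^{\alpha_N}v(k)},$$ where $C$ is the normalization constant $$C=\left[\sum_{\alpha_1=0}^\infty\cdots\sum_{\alpha_N=0}^\infty\left(\frac{c_0^{\alpha_1}}{c^{\alpha_1}\prod_{k=1}^{\alpha_1}v(k)}\times\frac{c_0^{\alpha_2}}{c^{\alpha_2}\prod_{k=1}^{\alpha_2}v(k)}\times\cdots\times\frac{c_0^{\alpha_N}}{c^{\alpha_N}\prod_{k=1}^{\alpha_N}v(k)}\right)\right]^{-1},$$ and $\prod_{k=1}^{\alpha_j}v(k)\equiv 1$ if $\alpha_j=0$.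
   Context: $\mathbb{N}=\{0,1,2,\dots\}$. The throttling function with integer parameter $\sigma_*\ge1$ is $v(x)=0$ for $x\le 0$, $v(x)=x/\sigma_*$ for $0\le x\le\sigma_*$, and $v(x)=1$ for $x\ge\sigma_*$. For $i\in\{0,\dots,N\}$ the operator $T_i$ models the move of one unit of data from stage $i$ to stage $i+1$ (stage $0$ is the input, stage $N+1$ the output): for $j\in\{1,\dots,N\}$, $(T_i(\boldsymbol{\alpha}))_j=\alpha_j-1$ if $j=i$, $(T_i(\boldsymbol{\alpha}))_j=\alpha_j+1$ if $j=i+1$, and $(T_i(\boldsymbol{\alpha}))_j=\alpha_j$ otherwise. $\boldsymbol{\sigma}(t)$ is the homogeneous continuous-time Markov chain with state space $\mathbb{N}^N$ whose only transitions are: from state $\boldsymbol{\alpha}$ to $T_0\boldsymbol{\alpha}$ at rate $c_0$, and from $\boldsymbol{\alpha}$ to $T_k\boldsymbol{\alpha}$ at rate $c\,v(\alpha_k)$ for $k=1,\dots,N$ (a rate of $0$ means that the transition does not occur). That is, $\Pr[\boldsymbol{\sigma}(t+\Delta t)=T_0\boldsymbol{\alpha}\mid\boldsymbol{\sigma}(t)=\boldsymbol{\alpha}]=c_0\Delta t+O(\Delta t^2)$ and $\Pr[\boldsymbol{\sigma}(t+\Delta t)=T_k\boldsymbol{\alpha}\mid\boldsymbol{\sigma}(t)=\boldsymbol{\alpha}]=c\,v(\alpha_k)\Delta t+O(\Delta t^2)$ for $1\le k\le N$, with all other changes of state having probability $O(\Delta t^2)$. A stationary distribution is a vector $\pi$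 with $\pi_{\boldsymbol{\alpha}}\ge0$, $\sum_{\boldsymbol{\alpha}}\pi_{\boldsymbol{\alpha}}=1$, and $\pi=\pi\mathbf{P}_t$ for all $t\ge0$, where $\mathbf{P}_t$ is the transition matrix of the chain. *)

theory Defs
  imports "HOL-Probability.Probability" "HOL-Library.Landau_Symbols"
begin

definition throttle :: "nat \<Rightarrow> real \<Rightarrow> real" where
  "throttle smax x =
     (if x \<le> 0 then 0 else if x \<le> real smax then x / real smax else 1)"

(* Vectors indexed by 1..N are extensional functions: they take the value "undefined"
   outside {1..N}, so that two of them are equal iff their N components agree. *)
definition states :: "nat \<Rightarrow> (nat \<Rightarrow> nat) set" where
  "states N = ({1..N} \<rightarrow>\<^sub>E UNIV)"

(* Subtraction is truncated, so for k in {1..N} this is the intended move only if \<alpha> k > 0.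
   If \<alpha> k = 0 the move has rate 0, and moves of rate 0 are never used below. *)
definition move :: "nat \<Rightarrow> nat \<Rightarrow> (nat \<Rightarrow> nat) \<Rightarrow> (nat \<Rightarrow> nat)" where
  "move N k \<alpha> =
     (\<lambda>j\<in>{1..N}. if j = k then \<alpha> j - 1 else if j = k + 1 then \<alpha> j + 1 else \<alpha> j)"

definition move_rate :: "nat \<Rightarrow> real \<Rightarrow> real \<Rightarrow> nat \<Rightarrow> (nat \<Rightarrow> nat) \<Rightarrow> real" where
  "move_rate smax c0 c k \<alpha> = (if k = 0 then c0 else c * throttle smax (real (\<alpha> k)))"

(* P t is the transition matrix at time t; only t \<ge> 0 and entries indexed by S matter. *)
definition transition_function :: "'s set \<Rightarrow> (real \<Rightarrow> 's \<Rightarrow> 's \<Rightarrow> real) \<Rightarrow> bool" where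
  "transition_function S P \<longleftrightarrow>
     (\<forall>t\<ge>0. \<forall>\<alpha>\<in>S. \<forall>\<beta>\<in>S. P t \<alpha> \<beta> \<ge> 0) \<and>
     (\<forall>t\<ge>0. \<forall>\<alpha>\<in>S. (P t \<alpha> has_sum 1) S) \<and>
     (\<forall>\<alpha>\<in>S. \<forall>\<beta>\<in>S. P 0 \<alpha> \<beta> = of_bool (\<alpha> = \<beta>)) \<and>
     (\<forall>s\<ge>0. \<forall>t\<ge>0. \<forall>\<alpha>\<in>S. \<forall>\<beta>\<in>S. ((\<lambda>\<gamma>. P s \<alpha> \<gamma> * P t \<gamma> \<beta>) has_sum P (s + t) \<alpha> \<beta>) S)"

(* The last condition is the Markov property together with homogeneity: conditionally on the
   states at times \<tau> 0 < ... < \<tau> n, the probability of being in \<beta> at time \<tau> n + h is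
   P h (a n) \<beta>, where a n is the state at time \<tau> n. *)
definition homogeneous_markov_chain ::
  "'a measure \<Rightarrow> 's set \<Rightarrow> (real \<Rightarrow> 'a \<Rightarrow> 's) \<Rightarrow> (real \<Rightarrow> 's \<Rightarrow> 's \<Rightarrow> real) \<Rightarrow> bool" where
  "homogeneous_markov_chain M S \<sigma> P \<longleftrightarrow>
     prob_space M \<and>
     (\<forall>t\<ge>0. \<sigma> t \<in> M \<rightarrow>\<^sub>M count_space S) \<and>
     transition_function S P \<and>
     (\<forall>n (\<tau> :: nat \<Rightarrow> real) a h \<beta>.
        0 \<le> \<tau> 0 \<longrightarrow> (\<forall>i<n. \<tau> i < \<tau> (Suc i)) \<longrightarrow> 0 \<le> h \<longrightarrow> \<beta> \<in> S \<longrightarrow>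
        \<P>(\<omega> in M. \<forall>i\<le>n. \<sigma> (\<tau> i) \<omega> = a i) > 0 \<longrightarrow>
        \<P>(\<omega> in M. \<sigma> (\<tau> n + h) \<omega> = \<beta> \<bar> \<forall>i\<le>n. \<sigma> (\<tau> i) \<omega> = a i) = P h (a n) \<beta>)"

(* The last condition says that all changes of state other than the permitted moves have,
   taken together, conditional probability O(h^2). *)
definition has_throttled_rates ::
  "'a measure \<Rightarrow> nat \<Rightarrow> nat \<Rightarrow> real \<Rightarrow> real \<Rightarrow> (real \<Rightarrow> 'a \<Rightarrow> nat \<Rightarrow> nat) \<Rightarrow> bool" where
  "has_throttled_rates M N smax c0 c \<sigma> \<longleftrightarrow>
     (\<forall>t\<ge>0. \<forall>\<alpha>\<in>states N. \<P>(\<omega> in M. \<sigma> t \<omega> = \<alpha>) > 0 \<longrightarrow>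
        (\<forall>k\<in>{0..N}. move_rate smax c0 c k \<alpha> > 0 \<longrightarrow>
           (\<lambda>h. \<P>(\<omega> in M. \<sigma> (t + h) \<omega> = move N k \<alpha> \<bar> \<sigma> t \<omega> = \<alpha>) - move_rate smax c0 c k \<alpha> * h)
             \<in> O[at_right 0](\<lambda>h. h\<^sup>2)) \<and>
        (\<lambda>h. \<P>(\<omega> in M. \<sigma> (t + h) \<omega> \<noteq> \<alpha> \<and>
                  \<not> (\<exists>k\<in>{0..N}. move_rate smax c0 c k \<alpha> > 0 \<and> \<sigma> (t + h) \<omega> = move N k \<alpha>)
               \<bar> \<sigma> t \<omega> = \<alpha>))
          \<in> O[at_right 0](\<lambda>h. h\<^sup>2))"

definition stationary_distribution ::
  "'s set \<Rightarrow> (real \<Rightarrow> 's \<Rightarrow> 's \<Rightarrow> real) \<Rightarrow> ('s \<Rightarrow> real) \<Rightarrow> bool" where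
  "stationary_distribution S P \<pi> \<longleftrightarrow>
     (\<forall>\<alpha>\<in>S. \<pi> \<alpha> \<ge> 0) \<and>
     (\<pi> has_sum 1) S \<and>
     (\<forall>t\<ge>0. \<forall>\<beta>\<in>S. ((\<lambda>\<alpha>. \<pi> \<alpha> * P t \<alpha> \<beta>) has_sum \<pi> \<beta>) S)"

definition weight :: "nat \<Rightarrow> nat \<Rightarrow> real \<Rightarrow> real \<Rightarrow> (nat \<Rightarrow> nat) \<Rightarrow> real" where
  "weight N smax c0 c \<alpha> =
     (\<Prod>j=1..N. c0 ^ \<alpha> j / (c ^ \<alpha> j * (\<Prod>k=1..\<alpha> j. throttle smax (real k))))"

(* If the weights were not summable, infsum and hence the constant would be 0; this cannot go
   unnoticed, since a stationary distribution has total mass 1. *)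
definition norm_const :: "nat \<Rightarrow> nat \<Rightarrow> real \<Rightarrow> real \<Rightarrow> real" where
  "norm_const N smax c0 c = inverse (\<Sum>\<^sub>\<infinity>\<alpha>\<in>states N. weight N smax c0 c \<alpha>)"

end

theory Submission
  imports Defs
begin

text \<open>
  The rates determine \<open>P\<close> to first order: \<open>P h = I + h Q + O(h\<^sup>2)\<close>, with a constant depending on the row.
  As the total jump rates are bounded, supermultiplicativity of \<open>t \<mapsto> P t \<alpha> \<alpha>\<close> also gives an error \<open>O(h)\<close>
  that is uniform in the row. If \<open>w Q = 0\<close>, dominated convergence thus makes the total variation of
  \<open>w P h - w\<close> an \<open>o(h)\<close>, and summing over \<open>n\<close> steps of length \<open>t / n\<close> yields \<open>w P t = w\<close>; no
  differential equation is needed. For the product weights, \<open>w Q = 0\<close> follows by telescoping along cycles of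
  moves that bring a unit of data from the input through all stages to the output. These cycles
  also show that every state leads to every other one, both for the chain itself (so that its
  rates pin down \<open>P\<close> at every state) and for \<open>P\<close>, which gives uniqueness: the positive part of a difference
  of two stationary distributions is invariant, and so vanishes everywhere or nowhere.
\<close>

section \<open>Infinite sums: dominated convergence and linearity\<close>

text \<open>A sum over \<open>S\<close> is an integral against the counting measure, so dominated
  convergence for integrals applies; \<open>infsetsum\<close> links the two notions.\<close>

lemma infsum_dominated_tendsto_zero:
  fixes d :: "nat \<Rightarrow> 'a \<Rightarrow> real"
  assumes w: "w summable_on S" "\<And>x. x \<in> S \<Longrightarrow> 0 \<le> w x"
    and d: "\<And>n x. x \<in> S \<Longrightarrow> 0 \<le> d n x" "\<And>n x. x \<in> S \<Longrightarrow> d n x \<le> C * w x"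
    and lim: "\<And>x. x \<in> S \<Longrightarrow> (\<lambda>n. d n x) \<longlonglongrightarrow> 0"
  shows "(\<lambda>n. infsum (d n) S) \<longlonglongrightarrow> 0"
proof -
  have dom: "(\<lambda>x. C * w x) summable_on S"
    using w(1) by (rule summable_on_cmult_right)
  have dom_abs: "Infinite_Set_Sum.abs_summable_on (\<lambda>x. C * w x) S"
    using dom by (metis summable_on_iff_abs_summable_on_real abs_summable_equivalent)
  have d_sum: "d n summable_on S" for n
    by (rule summable_on_comparison_test[OF dom]) (use d in auto)
  have "Infinite_Set_Sum.abs_summable_on (d n) S" for n
    using d_sum[of n] by (metis summable_on_iff_abs_summable_on_real abs_summable_equivalent)
  then have eq: "infsum (d n) S = integral\<^sup>L (count_space S) (d n)" for n
    unfolding infsetsum_def[symmetric] by (rule infsetsum_infsum[symmetric])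
  have "(\<lambda>n. integral\<^sup>L (count_space S) (d n)) \<longlonglongrightarrow> integral\<^sup>L (count_space S) (\<lambda>_. 0)"
  proof (rule integral_dominated_convergence)
    show "integrable (count_space S) (\<lambda>x. C * w x)"
      using dom_abs by (simp add: abs_summable_on_def)
  qed (use d lim in \<open>auto simp: AE_count_space\<close>)
  then show ?thesis by (simp add: eq)
qed

lemma has_sum_diff:
  fixes f g :: "'a \<Rightarrow> real"
  assumes "(f has_sum a) S" "(g has_sum b) S"
  shows "((\<lambda>x. f x - g x) has_sum (a - b)) S"
  using has_sum_add[OF assms(1) has_sum_uminusI[OF assms(2)]] by simp

lemma has_sum_sum:
  fixes f :: "'b \<Rightarrow> 'a \<Rightarrow> real"
  assumes "\<And>k. k \<in> K \<Longrightarrow> (f k has_sum a k) S"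
  shows "((\<lambda>x. \<Sum>k\<in>K. f k x) has_sum (\<Sum>k\<in>K. a k)) S"
  using assms by (induction K rule: infinite_finite_induct) (auto intro: has_sum_add)

lemma sum_insert_image:
  assumes "finite A" "inj_on f A" "a \<notin> f ` A"
  shows "sum g (insert a (f ` A)) = g a + (\<Sum>k\<in>A. g (f k))"
  using assms by (simp add: sum.reindex)

section \<open>Jump processes with bounded rates: first-order behaviour of the transition
  matrix\<close>

text \<open>All conditions concern the matrix \<open>P\<close> alone, away from any probability
  space. Only moves of positive rate are constrained, as a move of rate 0 may have a meaningless
  target. Rows sum to 1 and targets are distinct, so the deficit in \<open>other_prob\<close> is the
  probability of all other changes.\<close>

locale jump_process =
  fixes S :: "'s set" and P :: "real \<Rightarrow> 's \<Rightarrow> 's \<Rightarrow> real"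
    and K :: "'k set" and T :: "'k \<Rightarrow> 's \<Rightarrow> 's" and r :: "'k \<Rightarrow> 's \<Rightarrow> real" and L :: real
  assumes transition: "transition_function S P"
    and finite_K: "finite K"
    and T_in: "\<lbrakk>\<alpha> \<in> S; k \<in> K; r k \<alpha> > 0\<rbrakk> \<Longrightarrow> T k \<alpha> \<in> S - {\<alpha>}"
    and T_inj: "\<alpha> \<in> S \<Longrightarrow> inj_on (\<lambda>k. T k \<alpha>) {k\<in>K. r k \<alpha> > 0}"
    and rate_nonneg: "\<lbrakk>\<alpha> \<in> S; k \<in> K\<rbrakk> \<Longrightarrow> 0 \<le> r k \<alpha>"
    and rate_bound: "\<alpha> \<in> S \<Longrightarrow> (\<Sum>k\<in>K. r k \<alpha>) \<le> L"
    and jump_prob: "\<lbrakk>\<alpha> \<in> S; k \<in> K; r k \<alpha> > 0\<rbrakk> \<Longrightarrow>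
      (\<lambda>h. P h \<alpha> (T k \<alpha>) - r k \<alpha> * h) \<in> O[at_right 0](\<lambda>h. h\<^sup>2)"
    and other_prob: "\<alpha> \<in> S \<Longrightarrow>
      (\<lambda>h. 1 - P h \<alpha> \<alpha> - (\<Sum>k | k \<in> K \<and> r k \<alpha> > 0. P h \<alpha> (T k \<alpha>))) \<in> O[at_right 0](\<lambda>h. h\<^sup>2)"
begin

abbreviation (input) active where "active \<alpha> \<equiv> {k \<in> K. r k \<alpha> > 0}"

lemma finite_active [simp]: "finite (active \<alpha>)"
  using finite_K by simp

lemma sum_active:
  assumes "\<alpha> \<in> S"
  shows "(\<Sum>k\<in>K. r k \<alpha> * f k) = (\<Sum>k\<in>active \<alpha>. r k \<alpha> * f k)"
  using finite_K rate_nonneg[OF assms] by (intro sum.mono_neutral_right) force+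

lemma P_nonneg: "\<lbrakk>0 \<le> t; \<alpha> \<in> S; \<beta> \<in> S\<rbrakk> \<Longrightarrow> 0 \<le> P t \<alpha> \<beta>"
  and P_total: "\<lbrakk>0 \<le> t; \<alpha> \<in> S\<rbrakk> \<Longrightarrow> (P t \<alpha> has_sum 1) S"
  and P_zero: "\<lbrakk>\<alpha> \<in> S; \<beta> \<in> S\<rbrakk> \<Longrightarrow> P 0 \<alpha> \<beta> = of_bool (\<alpha> = \<beta>)"
  and P_add: "\<lbrakk>0 \<le> s; 0 \<le> t; \<alpha> \<in> S; \<beta> \<in> S\<rbrakk> \<Longrightarrow>
    ((\<lambda>\<gamma>. P s \<alpha> \<gamma> * P t \<gamma> \<beta>) has_sum P (s + t) \<alpha> \<beta>) S"
  using transition by (auto simp: transition_function_def)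

lemma P_sum_le_1:
  assumes "0 \<le> t" "\<alpha> \<in> S" "finite F" "F \<subseteq> S"
  shows "sum (P t \<alpha>) F \<le> 1"
  using finite_sum_le_has_sum[OF P_total[OF assms(1,2)] assms(3,4)] P_nonneg assms by auto

lemma P_le_1: "\<lbrakk>0 \<le> t; \<alpha> \<in> S; \<beta> \<in> S\<rbrakk> \<Longrightarrow> P t \<alpha> \<beta> \<le> 1"
  using P_sum_le_1[of t \<alpha> "{\<beta>}"] by simp

lemma P_add_ge:
  assumes "0 \<le> s" "0 \<le> t" "\<alpha> \<in> S" "\<beta> \<in> S" "\<gamma> \<in> S"
  shows "P s \<alpha> \<gamma> * P t \<gamma> \<beta> \<le> P (s + t) \<alpha> \<beta>"
  using finite_sum_le_has_sum[OF P_add[OF assms(1-4)], of "{\<gamma>}"] assms P_nonneg by auto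

lemma sum_targets:
  assumes "\<alpha> \<in> S"
  shows "sum f (insert \<alpha> ((\<lambda>k. T k \<alpha>) ` active \<alpha>)) = f \<alpha> + (\<Sum>k\<in>active \<alpha>. f (T k \<alpha>))"
  using T_in[OF assms] by (intro sum_insert_image T_inj[OF assms]) force+

text \<open>This measures how far row \<open>\<alpha>\<close> of \<open>P h\<close> is from
  \<open>I + h Q\<close>; row sums equal to 1 let the two parts control the diagonal entry as
  well.\<close>

definition err :: "real \<Rightarrow> 's \<Rightarrow> real" where
  "err h \<alpha> = (\<Sum>k\<in>active \<alpha>. \<bar>P h \<alpha> (T k \<alpha>) - r k \<alpha> * h\<bar>)
     + \<bar>1 - P h \<alpha> \<alpha> - (\<Sum>k\<in>active \<alpha>. P h \<alpha> (T k \<alpha>))\<bar>"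

lemma err_nonneg: "0 \<le> err h \<alpha>"
  unfolding err_def by (intro add_nonneg_nonneg sum_nonneg) auto

lemma err_bigo: "\<alpha> \<in> S \<Longrightarrow> (\<lambda>h. err h \<alpha>) \<in> O[at_right 0](\<lambda>h. h\<^sup>2)"
  unfolding err_def using jump_prob other_prob
  by (intro sum_in_bigo big_sum_in_bigo) auto

lemma err_small:
  assumes "\<alpha> \<in> S"
  shows "((\<lambda>h. err h \<alpha> / h) \<longlongrightarrow> 0) (at_right 0)"
proof -
  have "(\<lambda>h. err h \<alpha>) \<in> O[at_right 0](\<lambda>h. h\<^sup>2)"
    by (rule err_bigo[OF assms])
  also have "(\<lambda>h::real. h\<^sup>2) \<in> o[at_right 0](\<lambda>h. h)"
  proof (rule smalloI_tendsto)
    have "((\<lambda>h::real. h) \<longlongrightarrow> 0) (at_right 0)" by (rule tendsto_ident_at)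
    then show "((\<lambda>h::real. h\<^sup>2 / h) \<longlongrightarrow> 0) (at_right 0)"
      by (rule Lim_transform_eventually) (auto simp: eventually_at_filter power2_eq_square)
  qed (auto simp: eventually_at_filter)
  finally show ?thesis by (rule smalloD_tendsto)
qed

text \<open>Being at \<open>\<alpha>\<close> at each of the times \<open>h\<close>,
  \<open>2 * h\<close>, ..., \<open>n * h\<close> is one way of being there at the last of
  them.\<close>

lemma P_diag_power:
  assumes "0 \<le> h" "\<alpha> \<in> S"
  shows "P h \<alpha> \<alpha> ^ n \<le> P (real n * h) \<alpha> \<alpha>"
proof (induction n)
  case (Suc n)
  have "P h \<alpha> \<alpha> ^ Suc n \<le> P h \<alpha> \<alpha> * P (real n * h) \<alpha> \<alpha>"
    using Suc P_nonneg assms by (simp add: mult_left_mono)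
  also have "\<dots> \<le> P (h + real n * h) \<alpha> \<alpha>"
    using assms by (intro P_add_ge) auto
  finally show ?case by (simp add: algebra_simps)
qed (use P_zero assms in simp)

lemma one_minus_P_diag:
  assumes "\<alpha> \<in> S"
  shows "1 - P h \<alpha> \<alpha> \<le> err h \<alpha> + h * (\<Sum>k\<in>K. r k \<alpha>)"
proof -
  have "1 - P h \<alpha> \<alpha> = (1 - P h \<alpha> \<alpha> - (\<Sum>k\<in>active \<alpha>. P h \<alpha> (T k \<alpha>)))
      + (\<Sum>k\<in>active \<alpha>. P h \<alpha> (T k \<alpha>) - r k \<alpha> * h) + h * (\<Sum>k\<in>active \<alpha>. r k \<alpha>)"
    by (simp add: sum_subtractf sum_distrib_left sum_distrib_right mult.commute)
  also have "\<dots> \<le> err h \<alpha> + h * (\<Sum>k\<in>active \<alpha>. r k \<alpha>)"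
    using sum_mono[of "active \<alpha>", OF abs_ge_self, of "\<lambda>k. P h \<alpha> (T k \<alpha>) - r k \<alpha> * h"]
    unfolding err_def by linarith
  also have "(\<Sum>k\<in>active \<alpha>. r k \<alpha>) = (\<Sum>k\<in>K. r k \<alpha>)"
    using sum_active[OF assms, of "\<lambda>_. 1"] by simp
  finally show ?thesis .
qed

text \<open>Since \<open>t \<mapsto> P t \<alpha> \<alpha>\<close> is supermultiplicative, its derivative at \<open>0\<close> controls it
  for all times.\<close>

lemma P_diag_ge:
  assumes "\<alpha> \<in> S" "0 \<le> t"
  shows "1 - P t \<alpha> \<alpha> \<le> t * (\<Sum>k\<in>K. r k \<alpha>)"
proof (cases "t = 0")
  case True
  then show ?thesis using P_zero[OF assms(1) assms(1)] by simp
next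
  case False
  with assms have t: "t > 0" by simp
  define h where "h n = t / real (Suc n)" for n
  have h: "h n > 0" "real (Suc n) * h n = t" for n
    using t by (auto simp: h_def)
  have "h \<longlonglongrightarrow> 0"
    unfolding h_def by (rule LIMSEQ_Suc[OF lim_const_over_n])
  then have "filterlim h (at_right 0) sequentially"
    using h(1) by (auto simp: filterlim_at less_imp_neq[symmetric])
  then have "(\<lambda>n. err (h n) \<alpha> / h n) \<longlonglongrightarrow> 0"
    using err_small[OF assms(1)] by (rule filterlim_compose[rotated])
  then have "(\<lambda>n. t * (err (h n) \<alpha> / h n + (\<Sum>k\<in>K. r k \<alpha>))) \<longlonglongrightarrow> t * (0 + (\<Sum>k\<in>K. r k \<alpha>))"
    by (intro tendsto_intros)
  moreover have "1 - P t \<alpha> \<alpha> \<le> t * (err (h n) \<alpha> / h n + (\<Sum>k\<in>K. r k \<alpha>))" for n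
  proof -
    \<comment> \<open>Bernoulli's inequality bounds the product over all steps below by its
      linearization, whose error per unit of time, \<open>err (h n) \<alpha> / h n\<close>, vanishes
      in the limit.\<close>
    have "1 - real (Suc n) * (err (h n) \<alpha> + h n * (\<Sum>k\<in>K. r k \<alpha>))
        \<le> 1 + real (Suc n) * (P (h n) \<alpha> \<alpha> - 1)"
      using mult_left_mono[OF one_minus_P_diag[OF assms(1), of "h n"], of "real (Suc n)"]
      by (simp add: algebra_simps)
    also have "\<dots> \<le> (1 + (P (h n) \<alpha> \<alpha> - 1)) ^ Suc n"
      using P_nonneg[of "h n" \<alpha> \<alpha>] h(1)[of n] assms by (intro Bernoulli_inequality) auto
    also have "\<dots> \<le> P t \<alpha> \<alpha>"
      using P_diag_power[of "h n" \<alpha> "Suc n"] h[of n] assms by simp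
    finally have "1 - P t \<alpha> \<alpha> \<le> real (Suc n) * (err (h n) \<alpha> + h n * (\<Sum>k\<in>K. r k \<alpha>))"
      by simp
    also have "\<dots> = real (Suc n) * h n * (err (h n) \<alpha> / h n + (\<Sum>k\<in>K. r k \<alpha>))"
      using h(1)[of n] by (simp add: field_simps)
    finally show ?thesis by (simp only: h(2))
  qed
  ultimately show ?thesis
    by (intro LIMSEQ_le_const) auto
qed

text \<open>The jump probabilities that bound the first part of \<open>err\<close> cancel against
  those subtracted in the deficit. This leaves \<open>1 - P h \<alpha> \<alpha>\<close> plus
  \<open>h\<close> times the total rate, each at most \<open>L * h\<close>. Being uniform in
  \<open>\<alpha>\<close>, the bound later dominates the sums of errors.\<close>

lemma err_le:
  assumes "\<alpha> \<in> S" "0 \<le> h"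
  shows "err h \<alpha> \<le> 2 * L * h"
proof -
  have tin: "insert \<alpha> ((\<lambda>k. T k \<alpha>) ` active \<alpha>) \<subseteq> S"
    using T_in[OF assms(1)] assms by auto
  have "P h \<alpha> \<alpha> + (\<Sum>k\<in>active \<alpha>. P h \<alpha> (T k \<alpha>)) \<le> 1"
    using P_sum_le_1[OF assms(2,1) _ tin] by (simp add: sum_targets assms)
  then have "err h \<alpha> = (\<Sum>k\<in>active \<alpha>. \<bar>P h \<alpha> (T k \<alpha>) - r k \<alpha> * h\<bar>)
      + (1 - P h \<alpha> \<alpha> - (\<Sum>k\<in>active \<alpha>. P h \<alpha> (T k \<alpha>)))"
    by (simp add: err_def)
  also have "(\<Sum>k\<in>active \<alpha>. \<bar>P h \<alpha> (T k \<alpha>) - r k \<alpha> * h\<bar>)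
      \<le> (\<Sum>k\<in>active \<alpha>. P h \<alpha> (T k \<alpha>) + r k \<alpha> * h)"
  proof (rule sum_mono)
    fix k assume k: "k \<in> active \<alpha>"
    then have "0 \<le> P h \<alpha> (T k \<alpha>)" "0 \<le> r k \<alpha> * h"
      using P_nonneg[of h \<alpha> "T k \<alpha>"] T_in[of \<alpha> k] assms by auto
    then show "\<bar>P h \<alpha> (T k \<alpha>) - r k \<alpha> * h\<bar> \<le> P h \<alpha> (T k \<alpha>) + r k \<alpha> * h"
      by linarith
  qed
  also have "\<dots> = (\<Sum>k\<in>active \<alpha>. P h \<alpha> (T k \<alpha>)) + h * (\<Sum>k\<in>K. r k \<alpha>)"
    using sum_active[OF assms(1), of "\<lambda>_. h"]
    by (simp add: sum.distrib sum_distrib_right sum_distrib_left mult.commute)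
  finally have "err h \<alpha> \<le> 1 - P h \<alpha> \<alpha> + h * (\<Sum>k\<in>K. r k \<alpha>)" by simp
  also have "\<dots> \<le> 2 * (h * (\<Sum>k\<in>K. r k \<alpha>))"
    using P_diag_ge[OF assms] by simp
  also have "\<dots> \<le> 2 * (h * L)"
    using rate_bound[OF assms(1)] assms(2) by (intro mult_left_mono) auto
  finally show ?thesis by (simp add: mult_ac)
qed

text \<open>The generator \<open>Q\<close> applied to \<open>g\<close>; its diagonal, minus the
  total rate, is absorbed in the term \<open>- g \<alpha>\<close>.\<close>

definition gen :: "('s \<Rightarrow> real) \<Rightarrow> 's \<Rightarrow> real" where
  "gen g \<alpha> = (\<Sum>k\<in>K. r k \<alpha> * (g (T k \<alpha>) - g \<alpha>))"

text \<open>Row sums 1 turn \<open>x - g \<alpha>\<close> into the sum of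
  \<open>P h \<alpha> \<gamma> * (g \<gamma> - g \<alpha>)\<close>. Values of \<open>g\<close>
  differ by at most 1, so the targets of moves and the remaining states contribute errors no larger
  than the two parts of \<open>err\<close>.\<close>

lemma generator_error:
  assumes \<alpha>: "\<alpha> \<in> S" and h: "0 \<le> h" and g: "\<And>\<gamma>. \<gamma> \<in> S \<Longrightarrow> 0 \<le> g \<gamma> \<and> g \<gamma> \<le> 1"
    and x: "((\<lambda>\<gamma>. P h \<alpha> \<gamma> * g \<gamma>) has_sum x) S"
  shows "\<bar>x - g \<alpha> - h * gen g \<alpha>\<bar> \<le> err h \<alpha>"
proof -
  define F where "F = insert \<alpha> ((\<lambda>k. T k \<alpha>) ` active \<alpha>)"
  have F: "finite F" "F \<subseteq> S"
    using T_in[OF \<alpha>] \<alpha> by (auto simp: F_def)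
  let ?f = "\<lambda>\<gamma>. P h \<alpha> \<gamma> * (g \<gamma> - g \<alpha>)"
  have "((\<lambda>\<gamma>. P h \<alpha> \<gamma> * g \<gamma> + P h \<alpha> \<gamma> * (- g \<alpha>)) has_sum (x + 1 * (- g \<alpha>))) S"
    by (intro has_sum_add x has_sum_cmult_left P_total h \<alpha>)
  then have "(?f has_sum (x - g \<alpha>)) S"
    by (simp add: algebra_simps)
  then have rest: "(?f has_sum (x - g \<alpha> - sum ?f F)) (S - F)"
    using has_sum_Diff[OF _ has_sum_finite[OF F(1)] F(2)] by blast
  have rest_P: "(P h \<alpha> has_sum (1 - sum (P h \<alpha>) F)) (S - F)"
    using has_sum_Diff[OF P_total[OF h \<alpha>] has_sum_finite[OF F(1)] F(2)] .
  have *: "\<bar>g \<gamma> - g \<alpha>\<bar> \<le> 1" if "\<gamma> \<in> S" for \<gamma>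
    using g[OF that] g[OF \<alpha>] by (auto simp: abs_le_iff)
  have "?f \<gamma> \<le> P h \<alpha> \<gamma> \<and> - P h \<alpha> \<gamma> \<le> ?f \<gamma>" if "\<gamma> \<in> S - F" for \<gamma>
  proof -
    have "\<bar>?f \<gamma>\<bar> \<le> P h \<alpha> \<gamma>"
      using P_nonneg[OF h \<alpha>, of \<gamma>] *[of \<gamma>] that by (simp add: abs_mult mult_left_le)
    then show ?thesis by linarith
  qed
  then have "x - g \<alpha> - sum ?f F \<le> 1 - sum (P h \<alpha>) F"
    and "- (1 - sum (P h \<alpha>) F) \<le> x - g \<alpha> - sum ?f F"
    using has_sum_mono[OF rest rest_P] has_sum_mono[OF has_sum_uminusI[OF rest_P] rest] by auto
  then have 1: "\<bar>x - g \<alpha> - sum ?f F\<bar> \<le> 1 - P h \<alpha> \<alpha> - (\<Sum>k\<in>active \<alpha>. P h \<alpha> (T k \<alpha>))"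
    by (simp add: F_def sum_targets[OF \<alpha>] abs_le_iff)
  have "sum ?f F = (\<Sum>k\<in>active \<alpha>. P h \<alpha> (T k \<alpha>) * (g (T k \<alpha>) - g \<alpha>))"
    by (simp add: F_def sum_targets[OF \<alpha>])
  moreover have "h * gen g \<alpha> = (\<Sum>k\<in>active \<alpha>. h * (r k \<alpha> * (g (T k \<alpha>) - g \<alpha>)))"
    unfolding gen_def sum_active[OF \<alpha>] by (rule sum_distrib_left)
  ultimately have "sum ?f F - h * gen g \<alpha>
      = (\<Sum>k\<in>active \<alpha>. (P h \<alpha> (T k \<alpha>) - r k \<alpha> * h) * (g (T k \<alpha>) - g \<alpha>))"
    by (simp only: sum_subtractf[symmetric], intro sum.cong refl, simp add: algebra_simps)
  also have "\<bar>\<dots>\<bar> \<le> (\<Sum>k\<in>active \<alpha>. \<bar>P h \<alpha> (T k \<alpha>) - r k \<alpha> * h\<bar>)"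
    using * T_in[OF \<alpha>]
    by (intro order.trans[OF sum_abs] sum_mono) (auto simp: abs_mult intro!: mult_left_le)
  finally show ?thesis
    using 1 unfolding err_def by linarith
qed

section \<open>From infinitesimal balance to stationarity\<close>

text \<open>The equation \<open>w Q = 0\<close> is assumed in weak form, tested against functions
  with values between 0 and 1, because the columns of \<open>P s\<close> are such functions.\<close>

lemma stationary_if_balanced:
  assumes w: "\<And>\<alpha>. \<alpha> \<in> S \<Longrightarrow> 0 \<le> w \<alpha>" "(w has_sum 1) S"
    and balance: "\<And>g. (\<And>\<gamma>. \<gamma> \<in> S \<Longrightarrow> 0 \<le> g \<gamma> \<and> g \<gamma> \<le> 1) \<Longrightarrow> ((\<lambda>\<alpha>. w \<alpha> * gen g \<alpha>) has_sum 0) S"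
  shows "stationary_distribution S P w"
  unfolding stationary_distribution_def
proof (intro conjI ballI allI impI w)
  fix t :: real and \<beta> assume t: "0 \<le> t" and \<beta>: "\<beta> \<in> S"
  define u where "u s = (\<Sum>\<^sub>\<infinity>\<alpha>\<in>S. w \<alpha> * P s \<alpha> \<beta>)" for s
  define E where "E h = (\<Sum>\<^sub>\<infinity>\<alpha>\<in>S. w \<alpha> * err h \<alpha>)" for h
  have w_sum: "w summable_on S"
    using w(2) by (rule has_sum_imp_summable)
  have u: "((\<lambda>\<alpha>. w \<alpha> * P s \<alpha> \<beta>) has_sum u s) S" if "0 \<le> s" for s
    unfolding u_def using that \<beta>
    by (intro has_sum_infsum summable_on_comparison_test[OF w_sum])
       (auto simp: P_nonneg P_le_1 w intro!: mult_left_le)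
  have E: "((\<lambda>\<alpha>. w \<alpha> * err h \<alpha>) has_sum E h) S" if "0 \<le> h" for h
    unfolding E_def using that w
    by (intro has_sum_infsum summable_on_comparison_test[OF summable_on_cmult_left[OF w_sum, of "2 * L * h"]])
       (auto simp: err_nonneg intro!: mult_left_mono err_le)
  \<comment> \<open>Chapman-Kolmogorov with the short step first: column \<open>\<beta>\<close> of
    \<open>P s\<close> becomes the test function \<open>g\<close>, and the column of
    \<open>P (h + s)\<close> is \<open>P h\<close> applied to it.\<close>
  have step: "\<bar>u (h + s) - u s\<bar> \<le> E h" if s: "0 \<le> s" and h: "0 \<le> h" for s h
  proof -
    define g where "g \<gamma> = P s \<gamma> \<beta>" for \<gamma>
    have g: "0 \<le> g \<gamma> \<and> g \<gamma> \<le> 1" if "\<gamma> \<in> S" for \<gamma>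
      using P_nonneg P_le_1 that s \<beta> by (simp add: g_def)
    \<comment> \<open>By \<open>balance\<close> the last term sums to 0, so subtracting it keeps the
      increment of \<open>u\<close> but makes each summand at most
      \<open>w \<alpha> * err h \<alpha>\<close> in absolute value.\<close>
    let ?X = "\<lambda>\<alpha>. w \<alpha> * P (h + s) \<alpha> \<beta> - w \<alpha> * P s \<alpha> \<beta> - h * (w \<alpha> * gen g \<alpha>)"
    have X: "(?X has_sum (u (h + s) - u s - h * 0)) S"
      using s h by (intro has_sum_diff u has_sum_cmult_right balance g) auto
    have "\<bar>?X \<alpha>\<bar> \<le> w \<alpha> * err h \<alpha>" if \<alpha>: "\<alpha> \<in> S" for \<alpha>
    proof -
      have "?X \<alpha> = w \<alpha> * (P (h + s) \<alpha> \<beta> - g \<alpha> - h * gen g \<alpha>)"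
        by (simp add: g_def algebra_simps)
      moreover have "\<bar>P (h + s) \<alpha> \<beta> - g \<alpha> - h * gen g \<alpha>\<bar> \<le> err h \<alpha>"
        using P_add[OF h s \<alpha> \<beta>] by (intro generator_error g \<alpha> h) (auto simp: g_def)
      ultimately show ?thesis
        using w(1)[OF \<alpha>] by (simp add: abs_mult mult_left_mono)
    qed
    then have "?X \<alpha> \<le> w \<alpha> * err h \<alpha> \<and> - (w \<alpha> * err h \<alpha>) \<le> ?X \<alpha>" if "\<alpha> \<in> S" for \<alpha>
      using that by (fastforce simp: abs_le_iff)
    then show ?thesis
      using has_sum_mono[OF X E[OF h]] has_sum_mono[OF has_sum_uminusI[OF E[OF h]] X]
      by (simp add: abs_le_iff)
  qed
  have steps: "\<bar>u (real n * h) - u 0\<bar> \<le> real n * E h" if h: "0 \<le> h" for n h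
  proof (induction n)
    case (Suc n)
    have "\<bar>u (h + real n * h) - u (real n * h)\<bar> \<le> E h"
      using h by (intro step) auto
    with Suc show ?case by (simp add: algebra_simps)
  qed simp
  have "u t = u 0"
  proof (cases "t = 0")
    case False
    with t have t: "t > 0" by simp
    define h where "h n = t / real (Suc n)" for n
    have h: "h n > 0" "real (Suc n) * h n = t" for n
      using t by (auto simp: h_def)
    have "h \<longlonglongrightarrow> 0"
      unfolding h_def by (rule LIMSEQ_Suc[OF lim_const_over_n])
    then have lim: "filterlim h (at_right 0) sequentially"
      using h(1) by (auto simp: filterlim_at less_imp_neq[symmetric])
    \<comment> \<open>Pointwise limits come from \<open>err_small\<close>, domination from
      \<open>err_le\<close>. The sum is \<open>E (h n) / h n\<close>, and \<open>Suc n\<close> steps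
      cost at most \<open>t\<close> times that.\<close>
    have "(\<lambda>n. \<Sum>\<^sub>\<infinity>\<alpha>\<in>S. w \<alpha> * err (h n) \<alpha> / h n) \<longlonglongrightarrow> 0"
    proof (rule infsum_dominated_tendsto_zero[OF w_sum, where C = "2 * L"])
      show "w \<alpha> * err (h n) \<alpha> / h n \<le> 2 * L * w \<alpha>" if "\<alpha> \<in> S" for \<alpha> n
        using mult_left_mono[OF err_le[OF that, of "h n"] w(1)[OF that]] h(1)[of n]
        by (simp add: divide_le_eq mult_ac)
      show "(\<lambda>n. w \<alpha> * err (h n) \<alpha> / h n) \<longlonglongrightarrow> 0" if "\<alpha> \<in> S" for \<alpha>
        using tendsto_mult_left[OF filterlim_compose[OF err_small[OF that] lim], of "w \<alpha>"] by simp
    qed (use w h in \<open>auto simp: err_nonneg less_imp_le\<close>)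
    moreover have "(\<Sum>\<^sub>\<infinity>\<alpha>\<in>S. w \<alpha> * err (h n) \<alpha> / h n) = E (h n) / h n" for n
      using has_sum_cmult_left[OF E[of "h n"], of "inverse (h n)"] h(1)[of n]
      by (auto simp: divide_inverse less_imp_le infsumI)
    ultimately have "(\<lambda>n. t * (E (h n) / h n)) \<longlonglongrightarrow> t * 0"
      by (intro tendsto_intros) simp
    moreover have "\<bar>u t - u 0\<bar> \<le> t * (E (h n) / h n)" for n
    proof -
      have "real (Suc n) = t / h n"
        using h[of n] by (simp add: field_simps)
      then show ?thesis
        using steps[of "h n" "Suc n"] h[of n] by simp
    qed
    ultimately have "\<bar>u t - u 0\<bar> \<le> t * 0"
      by (intro LIMSEQ_le_const) auto
    then show ?thesis by simp
  qed simp
  moreover have "u 0 = w \<beta>"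
  proof -
    have "((\<lambda>\<alpha>. w \<alpha> * P 0 \<alpha> \<beta>) has_sum w \<beta>) S"
      using \<beta> by (intro has_sum_finite_neutralI[where B = "{\<beta>}"]) (auto simp: P_zero)
    then show ?thesis using u[of 0] by (simp add: has_sum_unique)
  qed
  ultimately show "((\<lambda>\<alpha>. w \<alpha> * P t \<alpha> \<beta>) has_sum w \<beta>) S"
    using u[OF t] by simp
qed

section \<open>Uniqueness for irreducible transition matrices\<close>

text \<open>As the rows of \<open>P t\<close> sum to 1, exchanging the nonnegative sums shows that
  \<open>y\<close> has the same total mass \<open>Z\<close> as \<open>z\<close>; domination with
  equal totals forces equality.\<close>

lemma subinvariant_imp_invariant:
  assumes t: "0 \<le> t" and z: "\<And>\<alpha>. \<alpha> \<in> S \<Longrightarrow> 0 \<le> z \<alpha>" "(z has_sum Z) S"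
    and y: "\<And>\<beta>. \<beta> \<in> S \<Longrightarrow> ((\<lambda>\<alpha>. z \<alpha> * P t \<alpha> \<beta>) has_sum y \<beta>) S"
    and le: "\<And>\<beta>. \<beta> \<in> S \<Longrightarrow> z \<beta> \<le> y \<beta>"
    and \<beta>: "\<beta> \<in> S"
  shows "y \<beta> = z \<beta>"
proof -
  have inner: "((\<lambda>\<beta>. (\<lambda>(\<alpha>, \<beta>). z \<alpha> * P t \<alpha> \<beta>) (\<alpha>, \<beta>)) has_sum z \<alpha>) S" if "\<alpha> \<in> S" for \<alpha>
    using has_sum_cmult_right[OF P_total[OF t that], of "z \<alpha>"] by simp
  have summable: "(\<lambda>(\<alpha>, \<beta>). z \<alpha> * P t \<alpha> \<beta>) summable_on S \<times> S"
    using t z P_nonneg by (intro summable_on_SigmaI[OF inner has_sum_imp_summable]) auto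
  have "((\<lambda>(\<alpha>, \<beta>). z \<alpha> * P t \<alpha> \<beta>) has_sum Z) (S \<times> S)"
    by (rule has_sum_SigmaI[OF _ z(2) summable]) (use inner in auto)
  then have "((\<lambda>(\<beta>, \<alpha>). z \<alpha> * P t \<alpha> \<beta>) has_sum Z) (S \<times> S)"
    by (subst (asm) has_sum_swap) simp
  then have "(y has_sum Z) S"
    by (rule has_sum_SigmaD) (use y in simp)
  from has_sum_diff[OF this z(2)] have "y \<beta> - z \<beta> = 0"
    by (rule nonneg_has_sum_le_0D) (use le \<beta> in auto)
  then show ?thesis by simp
qed

lemma stationary_distribution_unique:
  assumes p: "stationary_distribution S P p" and q: "stationary_distribution S P q"
    and irreducible: "\<And>\<alpha> \<beta>. \<alpha> \<in> S \<Longrightarrow> \<beta> \<in> S \<Longrightarrow> \<exists>t\<ge>0. P t \<alpha> \<beta> > 0"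
    and "\<alpha> \<in> S"
  shows "p \<alpha> = q \<alpha>"
proof -
  define \<mu> where "\<mu> \<alpha> = p \<alpha> - q \<alpha>" for \<alpha>
  define z where "z \<alpha> = max 0 (\<mu> \<alpha>)" for \<alpha>
  have \<mu>: "(\<mu> has_sum 0) S"
    using has_sum_diff[of p S 1 q 1] p q by (simp add: stationary_distribution_def \<mu>_def[abs_def])
  have \<mu>_inv: "((\<lambda>\<alpha>. \<mu> \<alpha> * P t \<alpha> \<beta>) has_sum \<mu> \<beta>) S" if "0 \<le> t" "\<beta> \<in> S" for t \<beta>
    using has_sum_diff[of "\<lambda>\<alpha>. p \<alpha> * P t \<alpha> \<beta>" S "p \<beta>" "\<lambda>\<alpha>. q \<alpha> * P t \<alpha> \<beta>" "q \<beta>"] p q that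
    by (simp add: stationary_distribution_def \<mu>_def[abs_def] left_diff_distrib)
  have z_nonneg: "0 \<le> z \<alpha>" and z_ge: "\<mu> \<alpha> \<le> z \<alpha>" for \<alpha>
    by (auto simp: z_def)
  have "p summable_on S"
    using p by (auto simp: stationary_distribution_def intro: has_sum_imp_summable)
  then have z_sum: "z summable_on S"
    by (rule summable_on_comparison_test)
       (use p q in \<open>auto simp: z_def \<mu>_def stationary_distribution_def\<close>)
  have z_inv: "((\<lambda>\<alpha>. z \<alpha> * P t \<alpha> \<beta>) has_sum z \<beta>) S" if t: "0 \<le> t" and \<beta>: "\<beta> \<in> S" for t \<beta>
  proof -
    define y where "y \<beta> = (\<Sum>\<^sub>\<infinity>\<alpha>\<in>S. z \<alpha> * P t \<alpha> \<beta>)" for \<beta>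
    have y: "((\<lambda>\<alpha>. z \<alpha> * P t \<alpha> \<beta>) has_sum y \<beta>) S" if "\<beta> \<in> S" for \<beta>
      unfolding y_def using that t
      by (intro has_sum_infsum summable_on_comparison_test[OF z_sum])
         (auto simp: P_nonneg P_le_1 z_nonneg intro!: mult_left_le)
    \<comment> \<open>Invariance of \<open>\<mu>\<close> and \<open>\<mu> \<le> z\<close> give
      \<open>\<mu> \<beta> \<le> y \<beta>\<close>; as \<open>y\<close> is nonnegative, it dominates
      the positive part too.\<close>
    have "z \<beta> \<le> y \<beta>" if "\<beta> \<in> S" for \<beta>
    proof -
      have "\<mu> \<beta> \<le> y \<beta>"
        using P_nonneg t that
        by (intro has_sum_mono[OF \<mu>_inv[OF t that] y[OF that]] mult_right_mono z_ge) auto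
      moreover have "0 \<le> y \<beta>"
        using P_nonneg t that z_nonneg by (intro has_sum_nonneg[OF y[OF that]]) auto
      ultimately show ?thesis by (simp add: z_def)
    qed
    then have "y \<beta> = z \<beta>"
      using subinvariant_imp_invariant[OF t z_nonneg has_sum_infsum[OF z_sum] y _ \<beta>] by blast
    with y[OF \<beta>] show ?thesis by simp
  qed
  have \<mu>_nonpos: "\<mu> \<alpha> \<le> 0" if \<alpha>: "\<alpha> \<in> S" for \<alpha>
  proof (rule ccontr)
    assume pos: "\<not> \<mu> \<alpha> \<le> 0"
    \<comment> \<open>Irreducibility spreads the positivity of \<open>z\<close> from
      \<open>\<alpha>\<close> to every state, which contradicts the total mass 0 of
      \<open>\<mu>\<close>.\<close>
    have \<mu>_pos: "\<mu> \<beta> > 0" if \<beta>: "\<beta> \<in> S" for \<beta>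
    proof -
      obtain t where t: "0 \<le> t" "P t \<alpha> \<beta> > 0"
        using irreducible[OF \<alpha> \<beta>] by blast
      have "0 < z \<alpha> * P t \<alpha> \<beta>"
        using pos t by (simp add: z_def)
      also have "\<dots> \<le> z \<beta>"
        using finite_sum_le_has_sum[OF z_inv[OF t(1) \<beta>], of "{\<alpha>}"] \<alpha> \<beta> t P_nonneg z_nonneg by simp
      finally show ?thesis by (simp add: z_def max_def split: if_splits)
    qed
    then have "\<mu> \<alpha> = 0"
      using nonneg_has_sum_le_0D[OF \<mu> order_refl _ \<alpha>] by (simp add: less_imp_le)
    with pos show False by simp
  qed
  have "- \<mu> \<alpha> = 0"
    by (rule nonneg_has_sum_le_0D[OF has_sum_uminusI[OF \<mu>]]) (use \<mu>_nonpos assms(4) in auto)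
  then show ?thesis by (simp add: \<mu>_def)
qed

end

section \<open>The state space and its cycles of moves\<close>

text \<open>Think of \<open>\<gamma>\<close> with one more unit in transit, now at stage
  \<open>k\<close>; at the input \<open>0\<close> and the output \<open>N + 1\<close> this unit does
  not show. Adding units keeps truncated subtraction out of the cycle argument.\<close>

definition up :: "nat \<Rightarrow> nat \<Rightarrow> (nat \<Rightarrow> nat) \<Rightarrow> (nat \<Rightarrow> nat)" where
  "up N k \<gamma> = (\<lambda>j\<in>{1..N}. \<gamma> j + of_bool (j = k))"

lemma up_in_states [simp]: "up N k \<gamma> \<in> states N"
  by (auto simp: up_def states_def)

lemma move_in_states [simp]: "move N k \<alpha> \<in> states N"
  by (auto simp: move_def states_def)

lemma up_outside: "\<lbrakk>\<gamma> \<in> states N; k \<notin> {1..N}\<rbrakk> \<Longrightarrow> up N k \<gamma> = \<gamma>"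
  by (auto simp: up_def states_def PiE_def extensional_def)

lemma up_apply: "j \<in> {1..N} \<Longrightarrow> up N k \<gamma> j = \<gamma> j + of_bool (j = k)"
  by (simp add: up_def)

lemma move_up: "move N k (up N k \<gamma>) = up N (Suc k) \<gamma>"
  by (auto simp: move_def up_def)

lemma inj_on_up: "inj_on (up N k) (states N)"
proof (rule inj_onI)
  fix \<alpha> \<beta> assume \<alpha>\<beta>: "\<alpha> \<in> states N" "\<beta> \<in> states N" "up N k \<alpha> = up N k \<beta>"
  show "\<alpha> = \<beta>"
  proof (rule PiE_ext)
    show "\<alpha> j = \<beta> j" if "j \<in> {1..N}" for j
      using fun_cong[OF \<alpha>\<beta>(3), of j] that by (simp add: up_apply)
  qed (use \<alpha>\<beta> in \<open>auto simp: states_def\<close>)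
qed

text \<open>Thus a state admitting move \<open>k\<close> lies on a cycle at position
  \<open>k\<close>. The premise is conditional in order to cover \<open>k = 0\<close>, where
  \<open>up\<close> is the identity on states.\<close>

lemma state_eq_up:
  assumes \<alpha>: "\<alpha> \<in> states N" and pos: "k \<in> {1..N} \<Longrightarrow> \<alpha> k > 0"
  obtains \<gamma> where "\<gamma> \<in> states N" "\<alpha> = up N k \<gamma>"
proof
  let ?\<gamma> = "\<lambda>j\<in>{1..N}. \<alpha> j - of_bool (j = k)"
  show "?\<gamma> \<in> states N" by (auto simp: states_def)
  show "\<alpha> = up N k ?\<gamma>"
    using \<alpha> pos by (auto simp: up_def states_def PiE_def extensional_def fun_eq_iff)
qed

text \<open>The moves carry \<open>up N k \<gamma>\<close> to \<open>up N (k + 1) \<gamma>\<close>, and so run through the closed cycle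
  \<open>\<gamma> = up N 0 \<gamma>, up N 1 \<gamma>, \<dots>, up N N \<gamma>, up N (N + 1) \<gamma> = \<gamma>\<close>.\<close>

lemma closed_imp_all_states:
  assumes closed: "\<And>\<gamma> k. \<lbrakk>\<gamma> \<in> states N; k \<le> N; Q (up N k \<gamma>)\<rbrakk> \<Longrightarrow> Q (up N (Suc k) \<gamma>)"
    and \<alpha>: "\<alpha> \<in> states N" "Q \<alpha>" and \<beta>: "\<beta> \<in> states N"
  shows "Q \<beta>"
proof -
  have chain: "Q (up N l \<gamma>)" if "\<gamma> \<in> states N" "Q (up N k \<gamma>)" "k \<le> l" "l \<le> Suc N" for k l \<gamma>
    using that(3,4)
  proof (induction rule: dec_induct)
    case (step n)
    then show ?case using closed[OF that(1), of n] by simp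
  qed (use that in simp)
  \<comment> \<open>Positions \<open>0\<close> and \<open>N + 1\<close> of the cycle are both
    \<open>\<gamma>\<close>, so \<open>Q\<close> travels from \<open>\<gamma>\<close> to position
    \<open>k\<close> and onwards back to \<open>\<gamma>\<close>.\<close>
  have cycle: "Q (up N k \<gamma>) \<longleftrightarrow> Q \<gamma>" if "\<gamma> \<in> states N" "k \<in> {1..N}" for k \<gamma>
    using chain[OF that(1), of 0 k] chain[OF that(1), of k "Suc N"] that
    by (auto simp: up_outside)
  define z where "z = (\<lambda>j\<in>{1..N}. 0 :: nat)"
  \<comment> \<open>Units are removed one at a time, down to the empty state \<open>z\<close>; the
    equivalence lets \<open>Q\<close> descend from \<open>\<alpha>\<close> and climb to
    \<open>\<beta>\<close>.\<close>
  have zero: "Q \<alpha> \<longleftrightarrow> Q z" if "\<alpha> \<in> states N" for \<alpha>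
    using that
  proof (induction "\<Sum>j=1..N. \<alpha> j" arbitrary: \<alpha> rule: less_induct)
    case less
    show ?case
    proof (cases "\<exists>k\<in>{1..N}. \<alpha> k > 0")
      case True
      then obtain k where k: "k \<in> {1..N}" "\<alpha> k > 0" by blast
      then obtain \<gamma> where \<gamma>: "\<gamma> \<in> states N" "\<alpha> = up N k \<gamma>"
        using state_eq_up[OF less.prems] by metis
      have "(\<Sum>j=1..N. \<gamma> j) < (\<Sum>j=1..N. \<alpha> j)"
        using k \<gamma> by (intro sum_strict_mono_ex1) (auto simp: up_apply)
      then show ?thesis
        using less.hyps[OF _ \<gamma>(1)] cycle[OF \<gamma>(1) k(1)] \<gamma>(2) by simp
    next
      case False
      then have "\<alpha> = z"
        using less.prems by (auto simp: z_def states_def PiE_def extensional_def fun_eq_iff)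
      then show ?thesis by simp
    qed
  qed
  show ?thesis
    using zero[OF \<alpha>(1)] zero[OF \<beta>] \<alpha>(2) by simp
qed

section \<open>Rates and targets of the moves\<close>

lemma throttle_nat:
  assumes "smax \<ge> 1"
  shows "throttle smax (real n) > 0 \<longleftrightarrow> n > 0"
    and "0 \<le> throttle smax (real n)" and "throttle smax (real n) \<le> 1"
    and "n \<ge> smax \<Longrightarrow> throttle smax (real n) = 1"
  using assms by (auto simp: throttle_def field_simps)

lemma move_rate_pos_iff:
  assumes "smax \<ge> 1" "0 < c0" "0 < c"
  shows "move_rate smax c0 c k \<alpha> > 0 \<longleftrightarrow> (k > 0 \<longrightarrow> \<alpha> k > 0)"
  using assms throttle_nat(1)[OF assms(1), of "\<alpha> k"]
  by (auto simp: move_rate_def zero_less_mult_iff)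

lemma move_rate_nonneg:
  assumes "smax \<ge> 1" "0 < c0" "0 < c"
  shows "0 \<le> move_rate smax c0 c k \<alpha>"
  using assms throttle_nat(2)[OF assms(1)] by (auto simp: move_rate_def)

lemma move_rate_le:
  assumes "smax \<ge> 1" "0 < c0" "0 < c"
  shows "move_rate smax c0 c k \<alpha> \<le> c0 + c"
  using assms throttle_nat(3)[OF assms(1), of "\<alpha> k"]
  by (auto simp: move_rate_def intro: order.trans[OF mult_left_le])

lemma move_apply:
  "j \<in> {1..N} \<Longrightarrow> move N k \<alpha> j = (if j = k then \<alpha> j - 1 else if j = k + 1 then \<alpha> j + 1 else \<alpha> j)"
  by (simp add: move_def)

lemma move_neq:
  assumes "N \<ge> 1" "k \<le> N" "k > 0 \<longrightarrow> \<alpha> k > 0"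
  shows "move N k \<alpha> \<noteq> \<alpha>"
proof
  assume "move N k \<alpha> = \<alpha>"
  \<comment> \<open>Input changes stage 1, any other move takes a unit from stage
    \<open>k\<close>.\<close>
  from fun_cong[OF this, of "max 1 k"] show False
    using assms by (cases "k = 0") (auto simp: move_apply max_def split: if_splits)
qed

lemma inj_on_move: "inj_on (\<lambda>k. move N k \<alpha>) {k \<in> {0..N}. k > 0 \<longrightarrow> \<alpha> k > 0}"
proof (rule linorder_inj_onI')
  fix k l assume *: "k \<in> {k \<in> {0..N}. k > 0 \<longrightarrow> \<alpha> k > 0}"
    "l \<in> {k \<in> {0..N}. k > 0 \<longrightarrow> \<alpha> k > 0}" "k < l"
  show "move N k \<alpha> \<noteq> move N l \<alpha>"
  proof
    assume "move N k \<alpha> = move N l \<alpha>"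
    \<comment> \<open>Stage \<open>l\<close> tells the moves apart: \<open>move N l\<close> takes a
      unit from it, \<open>move N k\<close> with \<open>k < l\<close> does not.\<close>
    from fun_cong[OF this, of l] show False
      using * by (auto simp: move_apply split: if_splits)
  qed
qed

section \<open>Product weights: summability and balance\<close>

text \<open>The unnormalized stationary weight of a birth-death chain with birth rate
  \<open>c0\<close> and death rate \<open>c * throttle smax n\<close> at \<open>n\<close>.\<close>

definition weight1 :: "nat \<Rightarrow> real \<Rightarrow> real \<Rightarrow> nat \<Rightarrow> real" where
  "weight1 smax c0 c n = c0 ^ n / (c ^ n * (\<Prod>k=1..n. throttle smax (real k)))"

lemma weight_eq: "weight N smax c0 c \<alpha> = (\<Prod>j=1..N. weight1 smax c0 c (\<alpha> j))"
  by (simp add: weight_def weight1_def)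

context
  fixes smax :: nat and c0 c :: real
  assumes smax: "smax \<ge> 1" and c0: "0 < c0" and c: "0 < c"
begin

lemma weight1_pos: "weight1 smax c0 c n > 0"
  unfolding weight1_def using throttle_nat(1)[OF smax] c0 c
  by (intro divide_pos_pos mult_pos_pos prod_pos) auto

lemma weight_pos: "weight N smax c0 c \<alpha> > 0"
  unfolding weight_eq by (intro prod_pos) (simp add: weight1_pos)

text \<open>Detailed balance of this birth-death chain between \<open>n\<close> and
  \<open>n + 1\<close>.\<close>

lemma weight1_Suc:
  "weight1 smax c0 c (Suc n) * (c * throttle smax (real (Suc n))) = c0 * weight1 smax c0 c n"
proof -
  have "throttle smax (real (Suc n)) > 0"
    using throttle_nat(1)[OF smax] by blast
  then show ?thesis
    using c unfolding weight1_def by (simp add: field_simps)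
qed

text \<open>Partial balance: the rate into \<open>up N (k + 1) \<gamma>\<close> along the cycle does not depend on \<open>k\<close>.\<close>

lemma weight_up:
  assumes "\<gamma> \<in> states N" "k \<le> N"
  shows "weight N smax c0 c (up N k \<gamma>) * move_rate smax c0 c k (up N k \<gamma>) = c0 * weight N smax c0 c \<gamma>"
proof (cases "k = 0")
  case True
  then show ?thesis using assms by (simp add: up_outside move_rate_def)
next
  case False
  with assms have k: "k \<in> {1..N}" by simp
  define X where "X = (\<Prod>j\<in>{1..N} - {k}. weight1 smax c0 c (\<gamma> j))"
  have "(\<Prod>j\<in>{1..N} - {k}. weight1 smax c0 c (up N k \<gamma> j)) = X"
    unfolding X_def by (intro prod.cong) (auto simp: up_apply)
  then have "weight N smax c0 c (up N k \<gamma>) = weight1 smax c0 c (Suc (\<gamma> k)) * X"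
    unfolding weight_eq by (subst prod.remove[OF _ k]) (use k in \<open>simp_all add: up_apply\<close>)
  moreover have "weight N smax c0 c \<gamma> = weight1 smax c0 c (\<gamma> k) * X"
    unfolding weight_eq X_def by (rule prod.remove[OF _ k]) simp
  moreover have "move_rate smax c0 c k (up N k \<gamma>) = c * throttle smax (real (Suc (\<gamma> k)))"
    using k by (simp add: move_rate_def up_apply)
  ultimately show ?thesis
    using weight1_Suc[of "\<gamma> k"] by (simp add: mult_ac)
qed

text \<open>Beyond \<open>smax\<close> the throttle is 1, so consecutive one-stage weights have
  ratio \<open>c0 / c < 1\<close>. Products of absolutely summable families are absolutely summable
  over the product of the index sets.\<close>

lemma weight_summable:
  assumes "c0 < c"
  shows "weight N smax c0 c summable_on states N"
proof -
  have "weight1 smax c0 c (Suc n) = c0 / c * weight1 smax c0 c n" if "n \<ge> smax" for n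
    using weight1_Suc[of n] throttle_nat(4)[OF smax, of "Suc n"] that c by (simp add: field_simps)
  then have "summable (weight1 smax c0 c)"
    using weight1_pos c0 c assms
    by (intro summable_ratio_test[of "c0 / c" smax]) (auto simp: abs_of_pos)
  then have "Infinite_Set_Sum.abs_summable_on (weight1 smax c0 c) UNIV"
    using weight1_pos by (simp add: abs_summable_on_nat_iff' abs_of_pos)
  then have "Infinite_Set_Sum.abs_summable_on (\<lambda>\<alpha>. \<Prod>j=1..N. weight1 smax c0 c (\<alpha> j)) (states N)"
    unfolding states_def by (intro abs_summable_on_prod_PiE) auto
  then show ?thesis
    unfolding weight_eq[abs_def]
    by (metis summable_on_iff_abs_summable_on_real abs_summable_equivalent)
qed

lemma norm_const_has_sum:
  assumes "c0 < c"
  shows "((\<lambda>\<alpha>. norm_const N smax c0 c * weight N smax c0 c \<alpha>) has_sum 1) (states N)"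
    and "norm_const N smax c0 c > 0"
proof -
  let ?Z = "\<Sum>\<^sub>\<infinity>\<alpha>\<in>states N. weight N smax c0 c \<alpha>"
  \<comment> \<open>The state \<open>up N 0 (\<lambda>_. 0)\<close> is the empty one:
    \<open>up\<close> restricts the zero function to \<open>{1..N}\<close>.\<close>
  have "0 < weight N smax c0 c (up N 0 (\<lambda>_. 0))"
    by (rule weight_pos)
  also have "\<dots> \<le> ?Z"
    using finite_sum_le_infsum[OF weight_summable[OF assms], of "{up N 0 (\<lambda>_. 0)}"] weight_pos
    by (auto simp: less_imp_le)
  finally have Z: "0 < ?Z" .
  then show "norm_const N smax c0 c > 0"
    by (simp add: norm_const_def)
  show "((\<lambda>\<alpha>. norm_const N smax c0 c * weight N smax c0 c \<alpha>) has_sum 1) (states N)"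
    using has_sum_cmult_right[OF has_sum_infsum[OF weight_summable[OF assms, of N]], of "norm_const N smax c0 c"] Z
    by (simp add: norm_const_def)
qed

text \<open>Substituting \<open>\<alpha> = up N k \<gamma>\<close> and using partial balance, the
  \<open>k\<close>-th term sums to \<open>c0 * (A (Suc k) - A k)\<close>. The sum over
  \<open>k\<close> telescopes, and the cycle closes: \<open>A (Suc N) = A 0\<close>.\<close>

lemma weight_balance:
  assumes "c0 < c" and g: "\<And>\<gamma>. \<gamma> \<in> states N \<Longrightarrow> 0 \<le> g \<gamma> \<and> g \<gamma> \<le> 1"
  shows "((\<lambda>\<alpha>. weight N smax c0 c \<alpha> *
      (\<Sum>k\<in>{0..N}. move_rate smax c0 c k \<alpha> * (g (move N k \<alpha>) - g \<alpha>))) has_sum 0) (states N)"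
proof -
  let ?w = "weight N smax c0 c" and ?r = "move_rate smax c0 c"
  define A where "A k = (\<Sum>\<^sub>\<infinity>\<gamma>\<in>states N. ?w \<gamma> * g (up N k \<gamma>))" for k
  have A: "((\<lambda>\<gamma>. ?w \<gamma> * g (up N k \<gamma>)) has_sum A k) (states N)" for k
    unfolding A_def using weight_pos[THEN less_imp_le] g
    by (intro has_sum_infsum summable_on_comparison_test[OF weight_summable[OF assms(1)]])
       (auto intro: mult_left_le)
  have "((\<lambda>\<alpha>. ?w \<alpha> * (?r k \<alpha> * (g (move N k \<alpha>) - g \<alpha>))) has_sum c0 * (A (Suc k) - A k)) (states N)"
    (is "(?f has_sum _) _") if k: "k \<le> N" for k
  proof -
    have "((\<lambda>\<gamma>. c0 * (?w \<gamma> * g (up N (Suc k) \<gamma>) - ?w \<gamma> * g (up N k \<gamma>))) has_sum c0 * (A (Suc k) - A k)) (states N)"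
      by (intro has_sum_cmult_right has_sum_diff A)
    moreover have "c0 * (?w \<gamma> * g (up N (Suc k) \<gamma>) - ?w \<gamma> * g (up N k \<gamma>)) = (?f \<circ> up N k) \<gamma>"
      if "\<gamma> \<in> states N" for \<gamma>
    proof -
      have "(?f \<circ> up N k) \<gamma> = (?w (up N k \<gamma>) * ?r k (up N k \<gamma>)) * (g (up N (Suc k) \<gamma>) - g (up N k \<gamma>))"
        by (simp add: move_up)
      then show ?thesis
        unfolding weight_up[OF that k] by (simp add: algebra_simps)
    qed
    ultimately have "((?f \<circ> up N k) has_sum c0 * (A (Suc k) - A k)) (states N)"
      by (simp cong: has_sum_cong)
    then have "(?f has_sum c0 * (A (Suc k) - A k)) (up N k ` states N)"
      by (simp add: has_sum_reindex[OF inj_on_up])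
    \<comment> \<open>A state outside the image has nothing at stage \<open>k\<close>, so move
      \<open>k\<close> has rate 0 there.\<close>
    moreover have "?f \<alpha> = 0" if "\<alpha> \<in> states N - up N k ` states N" for \<alpha>
    proof -
      have "\<not> ?r k \<alpha> > 0"
        using that by (auto simp: move_rate_pos_iff[OF smax c0 c] elim: state_eq_up[of \<alpha> N k])
      then show ?thesis
        using move_rate_nonneg[OF smax c0 c, of k \<alpha>] by simp
    qed
    ultimately show ?thesis
      by (subst (asm) has_sum_cong_neutral[where S = "up N k ` states N" and T = "states N" and g = ?f]) auto
  qed
  then have "((\<lambda>\<alpha>. \<Sum>k\<in>{0..N}. ?w \<alpha> * (?r k \<alpha> * (g (move N k \<alpha>) - g \<alpha>)))
      has_sum (\<Sum>k\<in>{0..N}. c0 * (A (Suc k) - A k))) (states N)"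
    by (intro has_sum_sum) auto
  also have "(\<Sum>k\<in>{0..N}. c0 * (A (Suc k) - A k)) = c0 * (A (Suc N) - A 0)"
    by (simp add: sum_distrib_left[symmetric] sum_Suc_diff)
  also have "A (Suc N) = A 0"
    unfolding A_def by (intro infsum_cong) (simp add: up_outside)
  finally show ?thesis
    by (simp add: sum_distrib_left)
qed

end

section \<open>From the random process to its transition matrix\<close>

text \<open>Below \<open>a / C\<close> the linear term exceeds the error
  \<open>C * h\<^sup>2\<close>. This turns positive rates into jumps of positive
  probability.\<close>

lemma ex_pos_of_linear_asymptotics:
  fixes f :: "real \<Rightarrow> real"
  assumes "(\<lambda>h. f h - a * h) \<in> O[at_right 0](\<lambda>h. h\<^sup>2)" "a > 0"
  shows "\<exists>h>0. f h > 0"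
proof -
  obtain C where C: "C > 0" "eventually (\<lambda>h. \<bar>f h - a * h\<bar> \<le> C * h\<^sup>2) (at_right 0)"
    using landau_o.bigE[OF assms(1)] by auto
  have "eventually (\<lambda>h. 0 < h \<and> h < a / C) (at_right 0)"
    using C assms(2) by (intro eventually_at_rightI[of 0 "a / C"]) auto
  with C(2) have "eventually (\<lambda>h. 0 < h \<and> h < a / C \<and> \<bar>f h - a * h\<bar> \<le> C * h\<^sup>2) (at_right 0)"
    by eventually_elim simp
  then obtain h where h: "0 < h" "h < a / C" "\<bar>f h - a * h\<bar> \<le> C * h\<^sup>2"
    using eventually_happens[of _ "at_right (0::real)"] by auto
  have "C * h\<^sup>2 < a * h"
    using h(1,2) C(1) by (simp add: power2_eq_square field_simps)
  with h show ?thesis by (intro exI[of _ h]) linarith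
qed

context
  fixes M :: "'a measure" and S :: "'s set" and \<sigma> P
  assumes chain: "homogeneous_markov_chain M S \<sigma> P"
begin

interpretation prob_space M
  using chain by (simp add: homogeneous_markov_chain_def)

lemma chain_event:
  assumes "0 \<le> t"
  shows "{\<omega> \<in> space M. Q (\<sigma> t \<omega>)} \<in> sets M"
proof -
  have "\<sigma> t \<in> M \<rightarrow>\<^sub>M count_space S"
    using chain assms by (simp add: homogeneous_markov_chain_def)
  then have "\<sigma> t -` {s \<in> S. Q s} \<inter> space M \<in> sets M" and "\<sigma> t \<in> space M \<rightarrow> S"
    by (auto intro: measurable_sets[where A = "count_space S"] dest: measurable_space simp del: vimage_Collect_eq)
  moreover have "{\<omega> \<in> space M. Q (\<sigma> t \<omega>)} = \<sigma> t -` {s \<in> S. Q s} \<inter> space M"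
    using calculation(2) by auto
  ultimately show ?thesis by simp
qed

lemma chain_cond_prob:
  assumes "0 \<le> t" "0 \<le> h" "\<beta> \<in> S" "\<P>(\<omega> in M. \<sigma> t \<omega> = \<alpha>) > 0"
  shows "\<P>(\<omega> in M. \<sigma> (t + h) \<omega> = \<beta> \<bar> \<sigma> t \<omega> = \<alpha>) = P h \<alpha> \<beta>"
  \<comment> \<open>With the single observation time \<open>t\<close> the ordering condition on
    \<open>\<tau>\<close> is vacuous, so constant functions serve.\<close>
  using chain[unfolded homogeneous_markov_chain_def, THEN conjunct2, THEN conjunct2, THEN conjunct2,
      rule_format, of "\<lambda>_. t" 0 h \<beta> "\<lambda>_. \<alpha>"] assms
  by simp

text \<open>Finite additivity within the event \<open>\<sigma> t \<omega> = \<alpha>\<close>. It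
  converts the probability of all other changes into a deficit of row \<open>\<alpha>\<close> of
  \<open>P h\<close>.\<close>

lemma chain_cond_prob_notin:
  assumes t: "0 \<le> t" and h: "0 \<le> h" and F: "finite F" "F \<subseteq> S" and pos: "\<P>(\<omega> in M. \<sigma> t \<omega> = \<alpha>) > 0"
  shows "\<P>(\<omega> in M. \<sigma> (t + h) \<omega> \<notin> F \<bar> \<sigma> t \<omega> = \<alpha>) = 1 - (\<Sum>\<beta>\<in>F. P h \<alpha> \<beta>)"
proof -
  let ?B = "\<lambda>\<beta>. {\<omega> \<in> space M. \<sigma> (t + h) \<omega> = \<beta> \<and> \<sigma> t \<omega> = \<alpha>}"
  let ?A = "{\<omega> \<in> space M. \<sigma> t \<omega> = \<alpha>}"
  have ev: "?B \<beta> \<in> sets M" "?A \<in> sets M" for \<beta>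
    using chain_event[of "t + h" "\<lambda>s. s = \<beta>"] chain_event[of t "\<lambda>s. s = \<alpha>"] t h
    by (auto intro: sets.sets_Collect_conj)
  have "{\<omega> \<in> space M. \<sigma> (t + h) \<omega> \<notin> F \<and> \<sigma> t \<omega> = \<alpha>} = ?A - (\<Union>\<beta>\<in>F. ?B \<beta>)"
    by auto
  also have "prob \<dots> = prob ?A - prob (\<Union>\<beta>\<in>F. ?B \<beta>)"
    using F ev by (intro finite_measure_Diff) auto
  also have "prob (\<Union>\<beta>\<in>F. ?B \<beta>) = (\<Sum>\<beta>\<in>F. prob (?B \<beta>))"
    using F ev by (intro finite_measure_finite_Union) (auto simp: disjoint_family_on_def)
  also have "\<dots> = (\<Sum>\<beta>\<in>F. P h \<alpha> \<beta> * prob ?A)"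
    using chain_cond_prob[OF t h _ pos] F pos
    by (intro sum.cong) (auto simp: cond_prob_def field_simps)
  finally show ?thesis
    using pos by (simp add: cond_prob_def sum_distrib_right[symmetric] diff_divide_distrib)
qed

lemma chain_visited_step:
  assumes "0 \<le> t" "0 \<le> h" "\<beta> \<in> S" "\<P>(\<omega> in M. \<sigma> t \<omega> = \<alpha>) > 0" "P h \<alpha> \<beta> > 0"
  shows "\<P>(\<omega> in M. \<sigma> (t + h) \<omega> = \<beta>) > 0"
proof -
  have "0 < \<P>(\<omega> in M. \<sigma> (t + h) \<omega> = \<beta> \<and> \<sigma> t \<omega> = \<alpha>)"
    using chain_cond_prob[OF assms(1-4)] assms(4,5)
    by (metis cond_prob_def div_0 less_irrefl measure_nonneg order_less_le)
  also have "\<dots> \<le> \<P>(\<omega> in M. \<sigma> (t + h) \<omega> = \<beta>)"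
    using chain_event[of "t + h" "\<lambda>s. s = \<beta>"] assms by (intro finite_measure_mono) auto
  finally show ?thesis .
qed

text \<open>Otherwise the whole space would be a countable union of null sets. This supplies a first
  state at which the rates give information.\<close>

lemma chain_initial_state:
  assumes "countable S"
  obtains \<alpha> where "\<alpha> \<in> S" "\<P>(\<omega> in M. \<sigma> 0 \<omega> = \<alpha>) > 0"
proof -
  have "\<exists>\<alpha>\<in>S. \<P>(\<omega> in M. \<sigma> 0 \<omega> = \<alpha>) > 0"
  proof (rule ccontr)
    assume "\<not> ?thesis"
    then have zero: "\<P>(\<omega> in M. \<sigma> 0 \<omega> = \<alpha>) = 0" if "\<alpha> \<in> S" for \<alpha>
      using that by (auto simp: zero_less_measure_iff)
    have "(\<Union>\<alpha>\<in>S. {\<omega> \<in> space M. \<sigma> 0 \<omega> = \<alpha>}) \<in> null_sets M"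
    proof (rule null_sets_UN'[OF assms])
      fix \<alpha> assume "\<alpha> \<in> S"
      then show "{\<omega> \<in> space M. \<sigma> 0 \<omega> = \<alpha>} \<in> null_sets M"
        using zero chain_event[of 0 "\<lambda>s. s = \<alpha>"] by (auto simp: null_sets_def emeasure_eq_measure)
    qed
    moreover have "\<sigma> 0 \<in> space M \<rightarrow> S"
      using chain by (auto simp: homogeneous_markov_chain_def dest!: spec[of _ 0] measurable_space)
    then have "(\<Union>\<alpha>\<in>S. {\<omega> \<in> space M. \<sigma> 0 \<omega> = \<alpha>}) = space M"
      by auto
    ultimately show False
      using emeasure_space_1 by (simp add: null_sets_def)
  qed
  then show ?thesis using that by blast
qed

end

section \<open>Application to the throttled chain\<close>

theorem theorem5:
  fixes N smax :: nat and c0 c :: real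
    and M :: "'a measure" and \<sigma> :: "real \<Rightarrow> 'a \<Rightarrow> nat \<Rightarrow> nat"
    and P :: "real \<Rightarrow> (nat \<Rightarrow> nat) \<Rightarrow> (nat \<Rightarrow> nat) \<Rightarrow> real"
  assumes "N \<ge> 1" and "smax \<ge> 1" and "0 < c0" and "c0 < c"
    and "homogeneous_markov_chain M (states N) \<sigma> P"
    and "has_throttled_rates M N smax c0 c \<sigma>"
  shows "stationary_distribution (states N) P (\<lambda>\<alpha>. norm_const N smax c0 c * weight N smax c0 c \<alpha>)
    \<and> (\<forall>\<pi>. stationary_distribution (states N) P \<pi> \<longrightarrow>
          (\<forall>\<alpha>\<in>states N. \<pi> \<alpha> = norm_const N smax c0 c * weight N smax c0 c \<alpha>))"
proof -
  note chain = assms(5) and rates = assms(6)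
  from assms(3,4) have c: "0 < c" by simp
  let ?r = "move_rate smax c0 c"
  define act where "act \<alpha> = {k \<in> {0..N}. ?r k \<alpha> > 0}" for \<alpha>
  note pos_iff = move_rate_pos_iff[OF assms(2,3) c]
  have target: "move N k \<alpha> \<in> states N - {\<alpha>}" if "k \<in> act \<alpha>" for k \<alpha>
    using that move_neq[OF assms(1), of k \<alpha>] by (auto simp: act_def pos_iff)
  have inj: "inj_on (\<lambda>k. move N k \<alpha>) (act \<alpha>)" for \<alpha>
    using inj_on_move[of N \<alpha>] by (simp add: act_def pos_iff)
  have act_up: "k \<in> act (up N k \<gamma>)" if "k \<le> N" for k \<gamma>
    using that by (auto simp: act_def pos_iff up_apply)

  \<comment> \<open>The rates constrain \<open>P\<close> only at states that have positive
    probability at some time, so the expansions of \<open>P\<close> are first derived for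
    these.\<close>
  define visited where "visited \<alpha> \<longleftrightarrow> (\<exists>t\<ge>0. \<P>(\<omega> in M. \<sigma> t \<omega> = \<alpha>) > 0)" for \<alpha>
  have asymp: "(\<lambda>h. P h \<alpha> (move N k \<alpha>) - ?r k \<alpha> * h) \<in> O[at_right 0](\<lambda>h. h\<^sup>2)"
    if \<alpha>: "\<alpha> \<in> states N" "visited \<alpha>" and k: "k \<in> act \<alpha>" for \<alpha> k
  proof -
    obtain t where t: "0 \<le> t" "\<P>(\<omega> in M. \<sigma> t \<omega> = \<alpha>) > 0"
      using \<alpha>(2) by (auto simp: visited_def)
    have bigo: "(\<lambda>h. \<P>(\<omega> in M. \<sigma> (t + h) \<omega> = move N k \<alpha> \<bar> \<sigma> t \<omega> = \<alpha>) - ?r k \<alpha> * h) \<in> O[at_right 0](\<lambda>h. h\<^sup>2)"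
      using rates t \<alpha>(1) k by (auto simp: has_throttled_rates_def act_def)
    have ev: "eventually (\<lambda>h. \<P>(\<omega> in M. \<sigma> (t + h) \<omega> = move N k \<alpha> \<bar> \<sigma> t \<omega> = \<alpha>) - ?r k \<alpha> * h
        = P h \<alpha> (move N k \<alpha>) - ?r k \<alpha> * h) (at_right 0)"
      using chain_cond_prob[OF chain t(1) _ move_in_states t(2)]
      by (auto simp: eventually_at_filter)
    show ?thesis
      using landau_o.big.in_cong[OF ev] bigo by (rule iffD1)
  qed
  have other: "(\<lambda>h. 1 - P h \<alpha> \<alpha> - (\<Sum>k\<in>act \<alpha>. P h \<alpha> (move N k \<alpha>))) \<in> O[at_right 0](\<lambda>h. h\<^sup>2)"
    if \<alpha>: "\<alpha> \<in> states N" "visited \<alpha>" for \<alpha>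
  proof -
    obtain t where t: "0 \<le> t" "\<P>(\<omega> in M. \<sigma> t \<omega> = \<alpha>) > 0"
      using \<alpha>(2) by (auto simp: visited_def)
    define F where "F = insert \<alpha> ((\<lambda>k. move N k \<alpha>) ` act \<alpha>)"
    have F: "finite F" "F \<subseteq> states N"
      using \<alpha>(1) by (auto simp: F_def act_def)
    have "(\<lambda>h. \<P>(\<omega> in M. \<sigma> (t + h) \<omega> \<noteq> \<alpha> \<and>
        \<not> (\<exists>k\<in>{0..N}. ?r k \<alpha> > 0 \<and> \<sigma> (t + h) \<omega> = move N k \<alpha>) \<bar> \<sigma> t \<omega> = \<alpha>)) \<in> O[at_right 0](\<lambda>h. h\<^sup>2)"
      using rates t \<alpha>(1) by (simp add: has_throttled_rates_def)
    \<comment> \<open>Staying put and the permitted moves make up the finite set \<open>F\<close>,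
      so the other changes are its complement.\<close>
    also have "(\<lambda>h \<omega>. \<sigma> (t + h) \<omega> \<noteq> \<alpha> \<and> \<not> (\<exists>k\<in>{0..N}. ?r k \<alpha> > 0 \<and> \<sigma> (t + h) \<omega> = move N k \<alpha>))
        = (\<lambda>h \<omega>. \<sigma> (t + h) \<omega> \<notin> F)"
      by (auto simp: F_def act_def fun_eq_iff)
    finally have bigo: "(\<lambda>h. \<P>(\<omega> in M. \<sigma> (t + h) \<omega> \<notin> F \<bar> \<sigma> t \<omega> = \<alpha>)) \<in> O[at_right 0](\<lambda>h. h\<^sup>2)" .
    have "sum f F = f \<alpha> + (\<Sum>k\<in>act \<alpha>. f (move N k \<alpha>))" for f :: "_ \<Rightarrow> real"
      unfolding F_def using target by (intro sum_insert_image inj) (force simp: act_def)+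
    then have ev: "eventually (\<lambda>h. \<P>(\<omega> in M. \<sigma> (t + h) \<omega> \<notin> F \<bar> \<sigma> t \<omega> = \<alpha>)
        = 1 - P h \<alpha> \<alpha> - (\<Sum>k\<in>act \<alpha>. P h \<alpha> (move N k \<alpha>))) (at_right 0)"
      using chain_cond_prob_notin[OF chain t(1) _ F t(2)]
      by (auto simp: eventually_at_filter)
    show ?thesis
      using landau_o.big.in_cong[OF ev] bigo by (rule iffD1)
  qed
  have jump: "\<exists>h>0. P h \<alpha> (move N k \<alpha>) > 0" if "\<alpha> \<in> states N" "visited \<alpha>" "k \<in> act \<alpha>" for \<alpha> k
    using ex_pos_of_linear_asymptotics[OF asymp[OF that]] that(3) by (simp add: act_def)

  have "countable (states N)"
    unfolding states_def by (intro countable_PiE) auto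
  then obtain \<alpha>0 where \<alpha>0: "\<alpha>0 \<in> states N" "visited \<alpha>0"
    using chain_initial_state[OF chain] unfolding visited_def by (metis order_refl)
  \<comment> \<open>Each step of a cycle has positive probability from a visited state; hence all
    states are visited and the expansions hold everywhere.\<close>
  have visited: "visited \<beta>" if "\<beta> \<in> states N" for \<beta>
    using _ \<alpha>0 that
  proof (rule closed_imp_all_states)
    fix \<gamma> k assume \<gamma>: "\<gamma> \<in> states N" "k \<le> N" "visited (up N k \<gamma>)"
    then obtain t where t: "0 \<le> t" "\<P>(\<omega> in M. \<sigma> t \<omega> = up N k \<gamma>) > 0"
      by (auto simp: visited_def)
    obtain h where h: "h > 0" "P h (up N k \<gamma>) (up N (Suc k) \<gamma>) > 0"
      using jump[OF up_in_states \<gamma>(3) act_up[OF \<gamma>(2)]] by (auto simp: move_up)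
    have "\<P>(\<omega> in M. \<sigma> (t + h) \<omega> = up N (Suc k) \<gamma>) > 0"
      using h t by (intro chain_visited_step[OF chain]) auto
    with t h show "visited (up N (Suc k) \<gamma>)"
      unfolding visited_def by (intro exI[of _ "t + h"]) auto
  qed

  \<comment> \<open>Each of the \<open>N + 1\<close> rates is at most \<open>c0\<close> or at most
    \<open>c\<close>, hence at most \<open>c0 + c\<close>.\<close>
  interpret jump_process "states N" P "{0..N}" "move N" ?r "real (Suc N) * (c0 + c)"
  proof
    show "transition_function (states N) P"
      using chain by (simp add: homogeneous_markov_chain_def)
    show "move N k \<alpha> \<in> states N - {\<alpha>}" if "k \<in> {0..N}" "?r k \<alpha> > 0" for k \<alpha>
      using target[of k \<alpha>] that by (simp add: act_def)
    show "inj_on (\<lambda>k. move N k \<alpha>) {k \<in> {0..N}. ?r k \<alpha> > 0}" for \<alpha>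
      using inj[of \<alpha>] by (simp add: act_def)
    show "0 \<le> ?r k \<alpha>" for k \<alpha>
      by (rule move_rate_nonneg[OF assms(2,3) c])
    show "(\<Sum>k\<in>{0..N}. ?r k \<alpha>) \<le> real (Suc N) * (c0 + c)" for \<alpha>
      using sum_bounded_above[of "{0..N}" "\<lambda>k. ?r k \<alpha>", OF move_rate_le[OF assms(2,3) c]] by simp
    show "(\<lambda>h. P h \<alpha> (move N k \<alpha>) - ?r k \<alpha> * h) \<in> O[at_right 0](\<lambda>h. h\<^sup>2)"
      if "\<alpha> \<in> states N" "k \<in> {0..N}" "?r k \<alpha> > 0" for \<alpha> k
      using asymp[OF that(1) visited[OF that(1)]] that by (simp add: act_def)
    show "(\<lambda>h. 1 - P h \<alpha> \<alpha> - (\<Sum>k | k \<in> {0..N} \<and> ?r k \<alpha> > 0. P h \<alpha> (move N k \<alpha>))) \<in> O[at_right 0](\<lambda>h. h\<^sup>2)"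
      if "\<alpha> \<in> states N" for \<alpha>
      using other[OF that visited[OF that]] by (simp add: act_def)
  qed simp

  let ?p = "\<lambda>\<alpha>. norm_const N smax c0 c * weight N smax c0 c \<alpha>"
  have p: "stationary_distribution (states N) P ?p"
  proof (rule stationary_if_balanced)
    show "0 \<le> ?p \<alpha>" for \<alpha>
      using norm_const_has_sum(2)[OF assms(2,3) c assms(4), of N] weight_pos[OF assms(2,3) c, of N \<alpha>] by simp
    show "(?p has_sum 1) (states N)"
      by (rule norm_const_has_sum(1)[OF assms(2,3) c assms(4)])
    show "((\<lambda>\<alpha>. ?p \<alpha> * gen g \<alpha>) has_sum 0) (states N)"
      if "\<And>\<gamma>. \<gamma> \<in> states N \<Longrightarrow> 0 \<le> g \<gamma> \<and> g \<gamma> \<le> 1" for g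
      using has_sum_cmult_right[where c = "norm_const N smax c0 c",
        OF weight_balance[where N = N and g = g, OF assms(2,3) c assms(4) that]]
      by (simp add: gen_def mult.assoc)
  qed
  \<comment> \<open>The cycle argument again, now for the states that \<open>P\<close> reaches from
    \<open>\<alpha>\<close>, starting with \<open>\<alpha>\<close> itself at time 0.\<close>
  have irreducible: "\<exists>t\<ge>0. P t \<alpha> \<beta> > 0" if \<alpha>: "\<alpha> \<in> states N" and \<beta>: "\<beta> \<in> states N" for \<alpha> \<beta>
    using _ \<alpha> _ \<beta>
  proof (rule closed_imp_all_states)
    show "\<exists>t\<ge>0. P t \<alpha> \<alpha> > 0"
      using P_zero[OF \<alpha> \<alpha>] by (intro exI[of _ 0]) simp
    fix \<gamma> k assume \<gamma>: "\<gamma> \<in> states N" "k \<le> N" "\<exists>t\<ge>0. P t \<alpha> (up N k \<gamma>) > 0"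
    then obtain t where t: "0 \<le> t" "P t \<alpha> (up N k \<gamma>) > 0"
      by blast
    obtain h where h: "h > 0" "P h (up N k \<gamma>) (up N (Suc k) \<gamma>) > 0"
      using jump[OF up_in_states visited[OF up_in_states] act_up[OF \<gamma>(2)]] by (auto simp: move_up)
    have "0 < P t \<alpha> (up N k \<gamma>) * P h (up N k \<gamma>) (up N (Suc k) \<gamma>)"
      using t h by simp
    also have "\<dots> \<le> P (t + h) \<alpha> (up N (Suc k) \<gamma>)"
      using t h \<alpha> by (intro P_add_ge) auto
    finally show "\<exists>t\<ge>0. P t \<alpha> (up N (Suc k) \<gamma>) > 0"
      using t h by (intro exI[of _ "t + h"]) auto
  qed
  show ?thesis
    using p stationary_distribution_unique[OF _ p irreducible] by blast
qed

end
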